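(* Let $n\ge 1$ be an integer, let $a_0>0$ be real, let $u_1\in\mathbb{C}$ with $\Im(u_1)>0$, and let $\bar u_1$ be the complex conjugate of $u_1$. Define $$v(u)=a_0\,u\,(u-u_1)^n(u-\bar u_1)^n .$$ If $(v,(0,\infty))$ is the variance function of some natural exponential family, then $\Re(u_1)\le 0$.
   Context: Natural exponential family (NEF): let $\beta$ be a positive Radon measure on $\mathbb{R}$ that is not concentrated on one point, and suppose the interior $\Theta$ of $\{\theta\in\mathbb{R}: g(\theta)=\int e^{x\theta}\beta(dx)<\infty\}$ is not empty. The NEF with basis $\beta$ is $\mathcal{F}=\{F_\theta:\theta\in\Theta\}$, where $F_\theta(dx)=\exp[\theta x-\log g(\theta)]\,\beta(dx)$. (Without loss of generality one may take $0\in\Theta$ and $\beta(\mathbb{R})=1$.) Mean function and mean domain: $\mu(\theta)=\frac{d}{d\theta}\log g(\theta)$ for $\theta\in\Theta$, and the mean domain is $U=\mu(\Theta)$. The map $\mu:\Theta\to U$ is invertible, with inverse $\theta(\mu)$. Variance function: for $\mu\in U$ set $v_{\mathcal{F}}(\mu)=\int (x-\mu)^2F_{\theta(\mu)}(dx)$. The pair $(v_{\mathcal{F}},U)$ is called the variance function of $\mathcal{F}$. Thus "$(v,(0,\infty))$ is the variance function of some NEF" means that there is an NEF $\mathcal{F}$ whose mean domain is exactly $U=(0,\infty)$ and for which $v_{\mathcal{F}}(u)=v(u)$ for all $u\in(0,\infty)$. *)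

theory Defs
  imports "HOL-Analysis.Analysis"
begin

text \<open>On the real line every locally finite Borel measure is regular, so Radon measures are exactly
  the Borel measures that are finite on compact sets.\<close>

definition radon_measure :: "real measure \<Rightarrow> bool" where
  "radon_measure \<beta> \<longleftrightarrow> sets \<beta> = sets borel \<and> (\<forall>K. compact K \<longrightarrow> emeasure \<beta> K < \<infinity>)"

definition nef_laplace :: "real measure \<Rightarrow> real \<Rightarrow> ennreal" where
  "nef_laplace \<beta> \<theta> = (\<integral>\<^sup>+x. ennreal (exp (x * \<theta>)) \<partial>\<beta>)"

definition nef_params :: "real measure \<Rightarrow> real set" where
  "nef_params \<beta> = interior {\<theta>. nef_laplace \<beta> \<theta> < \<infinity>}"

text \<open>The second conjunct says that \<^term>\<open>\<beta>\<close> is not concentrated on one point; it also excludes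
  the zero measure.\<close>

definition nef_basis :: "real measure \<Rightarrow> bool" where
  "nef_basis \<beta> \<longleftrightarrow>
     radon_measure \<beta> \<and> (\<forall>c. emeasure \<beta> (UNIV - {c}) \<noteq> 0) \<and> nef_params \<beta> \<noteq> {}"

definition nef_log_laplace :: "real measure \<Rightarrow> real \<Rightarrow> real" where
  "nef_log_laplace \<beta> \<theta> = ln (enn2real (nef_laplace \<beta> \<theta>))"

definition nef_member :: "real measure \<Rightarrow> real \<Rightarrow> real measure" where
  "nef_member \<beta> \<theta> = density \<beta> (\<lambda>x. ennreal (exp (\<theta> * x - nef_log_laplace \<beta> \<theta>)))"

definition nef_mean :: "real measure \<Rightarrow> real \<Rightarrow> real" where
  "nef_mean \<beta> \<theta> = deriv (nef_log_laplace \<beta>) \<theta>"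

definition nef_mean_domain :: "real measure \<Rightarrow> real set" where
  "nef_mean_domain \<beta> = nef_mean \<beta> ` nef_params \<beta>"

definition nef_param_of_mean :: "real measure \<Rightarrow> real \<Rightarrow> real" where
  "nef_param_of_mean \<beta> = inv_into (nef_params \<beta>) (nef_mean \<beta>)"

definition nef_variance :: "real measure \<Rightarrow> real \<Rightarrow> real" where
  "nef_variance \<beta> \<mu> = (LINT x|nef_member \<beta> (nef_param_of_mean \<beta> \<mu>). (x - \<mu>)\<^sup>2)"

text \<open>The variance function and the mean domain do not depend on which basis generates the family,
  so quantifying over families amounts to quantifying over bases.\<close>

definition is_nef_variance_function :: "(real \<Rightarrow> real) \<Rightarrow> real set \<Rightarrow> bool" where
  "is_nef_variance_function v U \<longleftrightarrow>
     (\<exists>\<beta>. nef_basis \<beta> \<and> nef_mean_domain \<beta> = U \<and> (\<forall>u\<in>U. nef_variance \<beta> u = v u))"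

end

theory Submission
  imports Defs "HOL-Complex_Analysis.Complex_Analysis" "HOL-Real_Asymp.Real_Asymp"
begin

text \<open>The mean satisfies \<open>d\<mu>/d\<theta> = v(\<mu>)\<close>, so \<open>\<theta>\<close> is a primitive of \<open>1/v\<close> as a function of the mean \<open>u\<close>,
  and the Laplace transform \<open>G\<close> satisfies \<open>G'(\<theta>(u)) = u G(\<theta>(u))\<close>. Since \<open>1/v\<close> has a simple pole at
  \<open>0\<close>, this identity continues analytically around \<open>0\<close> to negative \<open>u\<close>, where \<open>\<theta>\<close> runs along
  a horizontal line in the strip on which \<open>G\<close> is holomorphic. As \<open>u\<close> tends to \<open>-\<infinity>\<close>, \<open>Re \<theta>(u)\<close>
  increases to a finite limit. If \<open>Re u1 > 0\<close>, then \<open>v(s) < \<bar>v(-s)\<bar>\<close> for \<open>s > 0\<close>, so this limit stays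
  inside the strip. There the logarithmic derivative \<open>u = G'/G\<close> would blow up like a power of exponent
  \<open>-1/(2n)\<close> of the distance, whereas a zero of \<open>G\<close> makes it a simple pole.\<close>

section \<open>Exponential moments and the complex Laplace transform\<close>

lemma power_le_exp:
  fixes d y :: real
  assumes "0 \<le> y" "0 < d"
  shows "y ^ k \<le> fact k / d ^ k * exp (d * y)"
proof -
  have "(d * y) ^ k / fact k \<le> exp (d * y)"
  proof -
    have "(d * y) ^ k / fact k \<le> (\<Sum>i\<le>k. (d * y) ^ i / fact i)"
      by (rule member_le_sum) (use assms in auto)
    also have "\<dots> \<le> exp (d * y)"
      unfolding exp_def using summable_exp_generic[of "d * y"] assms
      by (intro order.trans[OF _ sum_le_suminf[where I = "{..k}"]])
         (auto simp: field_simps scaleR_conv_of_real)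
    finally show ?thesis .
  qed
  then show ?thesis
    using assms by (simp add: field_simps power_mult_distrib)
qed

text \<open>Convexity of \<open>exp\<close> bounds the integrand at an intermediate parameter by the
  sum of the integrands at the two ends.\<close>

lemma convex_finite_nef_laplace:
  assumes "sets \<beta> = sets borel"
  shows "convex {\<theta>. nef_laplace \<beta> \<theta> < \<infinity>}"
proof (rule convexI)
  have [measurable_cong]: "sets \<beta> = sets borel" by fact
  fix s t u w :: real
  assume *: "s \<in> {\<theta>. nef_laplace \<beta> \<theta> < \<infinity>}" "t \<in> {\<theta>. nef_laplace \<beta> \<theta> < \<infinity>}"
    and uw: "0 \<le> u" "0 \<le> w" "u + w = 1"
  have u: "u = 1 - w"
    using uw by simp
  have "exp (x * (u * s + w * t)) \<le> exp (x * s) + exp (x * t)" for x :: real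
  proof -
    have "exp (u * (x * s) + w * (x * t)) \<le> u * exp (x * s) + w * exp (x * t)"
      using convex_onD[OF exp_convex, of w "x * s" "x * t"] uw u by simp
    also have "\<dots> \<le> exp (x * s) + exp (x * t)"
      using uw by (intro add_mono mult_left_le_one_le) auto
    finally show ?thesis by (simp add: algebra_simps)
  qed
  then have "nef_laplace \<beta> (u * s + w * t)
      \<le> (\<integral>\<^sup>+x. ennreal (exp (x * s)) + ennreal (exp (x * t)) \<partial>\<beta>)"
    unfolding nef_laplace_def
    by (intro nn_integral_mono) (simp flip: ennreal_plus)
  also have "\<dots> = nef_laplace \<beta> s + nef_laplace \<beta> t"
    unfolding nef_laplace_def by (rule nn_integral_add) auto
  also have "\<dots> < \<infinity>"
    using * by simp
  finally show "u *\<^sub>R s + w *\<^sub>R t \<in> {\<theta>. nef_laplace \<beta> \<theta> < \<infinity>}"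
    by simp
qed

lemma integrable_exp_iff:
  assumes "sets \<beta> = sets borel"
  shows "integrable \<beta> (\<lambda>x. exp (x * \<theta>) :: real) \<longleftrightarrow> nef_laplace \<beta> \<theta> < \<infinity>"
proof -
  have [measurable_cong]: "sets \<beta> = sets borel" by fact
  show ?thesis
    unfolding nef_laplace_def integrable_iff_bounded by simp
qed

text \<open>There is room \<open>e\<close> on both sides of \<open>t\<close>. One half of it absorbs
  the power of x (\<open>power_le_exp\<close>), the other half is the spare factor
  \<open>exp (d * \<bar>x\<bar>)\<close>, and \<open>exp (e * \<bar>x\<bar>)\<close> is dominated by
  the exponentials at \<open>t + e\<close> and \<open>t - e\<close>. The spare factor later
  dominates perturbations of the parameter, with one \<open>d\<close> for every
  \<open>k\<close>.\<close>

lemma integrable_moment_exp_abs: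
  assumes "sets \<beta> = sets borel" "t \<in> nef_params \<beta>"
  obtains d :: real where "d > 0"
    "\<And>k. integrable \<beta> (\<lambda>x. \<bar>x\<bar> ^ k * (exp (d * \<bar>x\<bar>) * exp (x * t)))"
proof -
  have [measurable_cong]: "sets \<beta> = sets borel" by fact
  obtain e where e: "e > 0" "cball t e \<subseteq> {\<theta>. nef_laplace \<beta> \<theta> < \<infinity>}"
    using assms(2) unfolding nef_params_def mem_interior_cball by blast
  have "{t + e, t - e} \<subseteq> {\<theta>. nef_laplace \<beta> \<theta> < \<infinity>}"
    using e by (intro order.trans[OF _ e(2)]) (auto simp: dist_real_def)
  then have int: "integrable \<beta> (\<lambda>x. exp (x * (t + e)) + exp (x * (t - e)))"
    by (intro Bochner_Integration.integrable_add) (auto simp: integrable_exp_iff[OF assms(1)])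
  have "integrable \<beta> (\<lambda>x. \<bar>x\<bar> ^ k * (exp (e/2 * \<bar>x\<bar>) * exp (x * t)))" for k
  proof (rule Bochner_Integration.integrable_bound)
    let ?C = "fact k / (e/2) ^ k"
    show "integrable \<beta> (\<lambda>x. ?C * (exp (x * (t + e)) + exp (x * (t - e))))"
      using int by simp
    have "\<bar>x\<bar> ^ k * (exp (e/2 * \<bar>x\<bar>) * exp (x * t))
        \<le> ?C * (exp (x * (t + e)) + exp (x * (t - e)))" for x :: real
    proof -
      have "\<bar>x\<bar> ^ k * (exp (e/2 * \<bar>x\<bar>) * exp (x * t))
          \<le> (?C * exp (e/2 * \<bar>x\<bar>)) * (exp (e/2 * \<bar>x\<bar>) * exp (x * t))"
        using e(1) by (intro mult_right_mono power_le_exp) auto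
      also have "\<dots> = ?C * exp (e * \<bar>x\<bar> + x * t)"
        by (simp add: mult_ac flip: exp_add)
      also have "\<dots> \<le> ?C * (exp (x * (t + e)) + exp (x * (t - e)))"
        using e(1) by (intro mult_left_mono) (cases "x \<ge> 0", auto simp: algebra_simps)
      finally show ?thesis .
    qed
    then show "AE x in \<beta>. norm (\<bar>x\<bar> ^ k * (exp (e/2 * \<bar>x\<bar>) * exp (x * t)))
        \<le> norm (?C * (exp (x * (t + e)) + exp (x * (t - e))))"
      using e(1) by (intro always_eventually) (auto intro: order.trans[OF _ abs_ge_self])
  qed simp
  then show ?thesis
    using that[of "e/2"] e(1) by auto
qed

text \<open>For \<open>k = 0\<close> this is the Laplace transform in a complex parameter; the
  higher moments are its successive derivatives on the strip over
  \<open>nef_params \<beta>\<close>.\<close>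

definition exp_moment :: "real measure \<Rightarrow> nat \<Rightarrow> complex \<Rightarrow> complex" where
  "exp_moment \<beta> k z = (LINT x|\<beta>. of_real x ^ k * exp (of_real x * z))"

lemma integrable_exp_moment:
  assumes "sets \<beta> = sets borel" "Re z \<in> nef_params \<beta>"
  shows "integrable \<beta> (\<lambda>x. of_real x ^ k * exp (of_real x * z))"
proof -
  have [measurable_cong]: "sets \<beta> = sets borel" by fact
  obtain d where d: "d > 0"
    "integrable \<beta> (\<lambda>x. \<bar>x\<bar> ^ k * (exp (d * \<bar>x\<bar>) * exp (x * Re z)))"
    using integrable_moment_exp_abs[OF assms] by metis
  from d(2) show ?thesis
  proof (rule Bochner_Integration.integrable_bound)
    have "\<bar>x\<bar> ^ k * exp (x * Re z) \<le> \<bar>x\<bar> ^ k * (exp (d * \<bar>x\<bar>) * exp (x * Re z))" for x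
      using d(1) by (intro mult_left_mono) auto
    then show "AE x in \<beta>. norm (of_real x ^ k * exp (of_real x * z))
        \<le> norm (\<bar>x\<bar> ^ k * (exp (d * \<bar>x\<bar>) * exp (x * Re z)))"
      by (intro always_eventually) (simp add: norm_mult norm_power abs_mult)
  qed simp
qed

lemma norm_exp_remainder:
  "norm (exp z - 1 - z) \<le> exp \<bar>Re z\<bar> * norm z ^ 2" for z :: complex
  using Taylor_exp[of z 1] by (simp add: power2_eq_square diff_diff_eq)

text \<open>Differentiation under the integral by a quadratic remainder: the integrand's error is at
  most \<open>norm h ^ 2\<close> times an integrable function independent of \<open>h\<close>, so
  the difference quotient is off by at most \<open>B * norm h\<close>.\<close>

lemma exp_moment_has_field_derivative:
  assumes "sets \<beta> = sets borel" "Re z \<in> nef_params \<beta>"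
  shows "(exp_moment \<beta> k has_field_derivative exp_moment \<beta> (Suc k) z) (at z)"
proof -
  have [measurable_cong]: "sets \<beta> = sets borel" by fact
  obtain d where d: "d > 0"
    "\<And>k. integrable \<beta> (\<lambda>x. \<bar>x\<bar> ^ k * (exp (d * \<bar>x\<bar>) * exp (x * Re z)))"
    using integrable_moment_exp_abs[OF assms] by metis
  define B where "B = (LINT x|\<beta>. \<bar>x\<bar> ^ (k+2) * (exp (d * \<bar>x\<bar>) * exp (x * Re z)))"
  have "open (nef_params \<beta>)"
    by (simp add: nef_params_def)
  then obtain e where e: "e > 0" "ball (Re z) e \<subseteq> nef_params \<beta>"
    using assms(2) openE by blast
  have bound: "norm (exp_moment \<beta> k (z + h) - exp_moment \<beta> k z - exp_moment \<beta> (Suc k) z * h)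
      \<le> B * norm h ^ 2" if h: "norm h < min d e" for h
  proof -
    have "\<bar>Re h\<bar> < e"
      using h abs_Re_le_cmod[of h] by linarith
    then have "Re (z + h) \<in> nef_params \<beta>"
      using e(2) by (auto simp: dist_real_def)
    let ?R = "\<lambda>x::real. of_real x ^ k * exp (of_real x * z)
        * (exp (of_real x * h) - 1 - of_real x * h)"
    have R: "?R = (\<lambda>x. of_real x ^ k * exp (of_real x * (z + h))
        - of_real x ^ k * exp (of_real x * z) - of_real x ^ Suc k * exp (of_real x * z) * h)"
      by (auto simp: algebra_simps exp_add)
    have int_R: "integrable \<beta> ?R"
      unfolding R by (intro Bochner_Integration.integrable_diff integrable_mult_left
          integrable_exp_moment[OF assms] integrable_exp_moment[OF assms(1) \<open>Re (z + h) \<in> _\<close>])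
    have "exp_moment \<beta> k (z + h) - exp_moment \<beta> k z - exp_moment \<beta> (Suc k) z * h
        = integral\<^sup>L \<beta> ?R"
      unfolding R exp_moment_def
      by (subst Bochner_Integration.integral_diff Bochner_Integration.integral_mult_left;
          (intro Bochner_Integration.integrable_diff integrable_mult_left
          integrable_exp_moment[OF assms] integrable_exp_moment[OF assms(1) \<open>Re (z + h) \<in> _\<close>])?)+
         simp
    also have "norm \<dots> \<le> (LINT x|\<beta>. norm (?R x))"
      by (rule integral_norm_bound)
    also have "\<dots> \<le> (LINT x|\<beta>. (\<bar>x\<bar> ^ (k+2) * (exp (d * \<bar>x\<bar>) * exp (x * Re z))) * norm h ^ 2)"
    proof (rule integral_mono)
      show "integrable \<beta> (\<lambda>x. norm (?R x))"
        using int_R by (rule integrable_norm)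
      show "integrable \<beta> (\<lambda>x. (\<bar>x\<bar> ^ (k+2) * (exp (d * \<bar>x\<bar>) * exp (x * Re z))) * norm h ^ 2)"
        by (intro integrable_mult_left d(2))
      fix x :: real
      have "norm (exp (of_real x * h) - 1 - of_real x * h)
          \<le> exp \<bar>x * Re h\<bar> * (\<bar>x\<bar> * norm h) ^ 2"
        using norm_exp_remainder[of "of_real x * h"] by (simp add: norm_mult)
      \<comment> \<open>The growth of the remainder is paid for by the spare exponential, since
        \<open>norm h < d\<close>.\<close>
      also have "\<bar>x * Re h\<bar> \<le> d * \<bar>x\<bar>"
        using h abs_Re_le_cmod[of h] unfolding abs_mult
        by (subst mult.commute) (intro mult_right_mono, auto)
      finally have "norm (exp (of_real x * h) - 1 - of_real x * h)
          \<le> exp (d * \<bar>x\<bar>) * (\<bar>x\<bar> * norm h) ^ 2"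
        by (simp add: mult_right_mono)
      then have "\<bar>x\<bar> ^ k * exp (x * Re z) * norm (exp (of_real x * h) - 1 - of_real x * h)
          \<le> \<bar>x\<bar> ^ k * exp (x * Re z) * (exp (d * \<bar>x\<bar>) * (\<bar>x\<bar> * norm h) ^ 2)"
        by (intro mult_left_mono) auto
      then show "norm (?R x) \<le> (\<bar>x\<bar> ^ (k+2) * (exp (d * \<bar>x\<bar>) * exp (x * Re z))) * norm h ^ 2"
        by (simp add: norm_mult norm_power power_mult_distrib power2_eq_square mult_ac)
    qed
    also have "\<dots> = B * norm h ^ 2"
      by (simp add: B_def)
    finally show ?thesis .
  qed
  let ?D = "\<lambda>h. (exp_moment \<beta> k (z + h) - exp_moment \<beta> k z) / h"
  have "((\<lambda>h. ?D h - exp_moment \<beta> (Suc k) z) \<longlongrightarrow> 0) (at 0)"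
  proof (rule Lim_null_comparison)
    have "\<forall>\<^sub>F h in at (0::complex). norm h < min d e \<and> h \<noteq> 0"
      using d(1) e(1) unfolding eventually_at by (intro exI[of _ "min d e"]) auto
    then show "\<forall>\<^sub>F h in at 0. norm (?D h - exp_moment \<beta> (Suc k) z) \<le> B * norm h"
    proof eventually_elim
      case (elim h)
      have "?D h - exp_moment \<beta> (Suc k) z
          = (exp_moment \<beta> k (z + h) - exp_moment \<beta> k z - exp_moment \<beta> (Suc k) z * h) / h"
        using elim by (simp add: field_simps)
      then show ?case
        using bound[of h] elim by (simp add: norm_divide field_simps power2_eq_square)
    qed
    show "((\<lambda>h. B * norm h) \<longlongrightarrow> 0) (at 0)"
      by (auto intro!: tendsto_eq_intros)
  qed
  then show ?thesis
    unfolding DERIV_def by (rule LIM_zero_cancel)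
qed

definition real_exp_moment :: "real measure \<Rightarrow> nat \<Rightarrow> real \<Rightarrow> real" where
  "real_exp_moment \<beta> k t = (LINT x|\<beta>. x ^ k * exp (x * t))"

lemma exp_moment_of_real:
  "exp_moment \<beta> k (of_real t) = of_real (real_exp_moment \<beta> k t)"
proof -
  have "(\<lambda>x. of_real x ^ k * exp (of_real x * of_real t))
      = (\<lambda>x. complex_of_real (x ^ k * exp (x * t)))"
  proof
    fix x
    have "exp (of_real x * of_real t) = complex_of_real (exp (x * t))"
      by (simp add: exp_of_real flip: of_real_mult)
    then show "of_real x ^ k * exp (of_real x * of_real t) = complex_of_real (x ^ k * exp (x * t))"
      by simp
  qed
  then show ?thesis
    unfolding exp_moment_def real_exp_moment_def by (simp only: integral_complex_of_real)
qed

lemma real_exp_moment_has_derivative: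
  assumes "sets \<beta> = sets borel" "t \<in> nef_params \<beta>"
  shows "(real_exp_moment \<beta> k has_real_derivative real_exp_moment \<beta> (Suc k) t) (at t)"
proof -
  have "((\<lambda>s. exp_moment \<beta> k (of_real s)) has_vector_derivative
      exp_moment \<beta> (Suc k) (of_real t)) (at t)"
    using assms by (intro has_vector_derivative_real_field exp_moment_has_field_derivative) auto
  from has_field_derivative_Re[OF this] show ?thesis
    by (simp add: exp_moment_of_real)
qed

lemma integrable_real_exp_moment:
  assumes "sets \<beta> = sets borel" "t \<in> nef_params \<beta>"
  shows "integrable \<beta> (\<lambda>x. x ^ k * exp (x * t))"
  using integrable_Re[OF integrable_exp_moment[of \<beta> "of_real t" k]] assms
  by (simp add: exp_of_real flip: of_real_mult of_real_power)

lemma nef_laplace_eq: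
  assumes "sets \<beta> = sets borel" "t \<in> nef_params \<beta>"
  shows "nef_laplace \<beta> t = ennreal (real_exp_moment \<beta> 0 t)"
  unfolding nef_laplace_def real_exp_moment_def
  using integrable_real_exp_moment[OF assms, of 0]
  by (simp add: nn_integral_eq_integral)

section \<open>Mean and variance in terms of exponential moments\<close>

text \<open>A zero integral would force f to vanish almost everywhere and so concentrate \<beta> on
  \<open>c\<close>. The exceptional point is there for the variance integrand, which vanishes at the
  mean.\<close>

lemma nef_basis_integral_pos:
  assumes "nef_basis \<beta>" "integrable \<beta> f" "\<And>x. f x \<ge> 0" "\<And>x. x \<noteq> c \<Longrightarrow> f x > (0::real)"
  shows "integral\<^sup>L \<beta> f > 0"
proof (rule ccontr)
  have sets: "sets \<beta> = sets borel"
    using assms(1) by (simp add: nef_basis_def radon_measure_def)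
  assume "\<not> integral\<^sup>L \<beta> f > 0"
  moreover have "integral\<^sup>L \<beta> f \<ge> 0"
    using assms(3) by (rule integral_nonneg_AE[OF always_eventually[OF allI]])
  ultimately have "AE x in \<beta>. f x = 0"
    using integral_nonneg_eq_0_iff_AE[OF assms(2)] assms(3) by auto
  then have "AE x in \<beta>. x = c"
    by eventually_elim (metis assms(4) less_irrefl)
  moreover have "{x \<in> space \<beta>. x \<noteq> c} = UNIV - {c}"
    by (auto simp: sets_eq_imp_space_eq[OF sets])
  ultimately have "emeasure \<beta> (UNIV - {c}) = 0"
    using AE_iff_measurable[of "UNIV - {c}" \<beta> "\<lambda>x. x = c"] sets by auto
  then show False
    using assms(1) by (simp add: nef_basis_def)
qed

context
  fixes \<beta> :: "real measure"
  assumes basis: "nef_basis \<beta>"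
begin

lemma nef_basis_sets: "sets \<beta> = sets borel"
  using basis by (simp add: nef_basis_def radon_measure_def)

lemma open_nef_params: "open (nef_params \<beta>)"
  by (simp add: nef_params_def)

lemma convex_nef_params: "convex (nef_params \<beta>)"
  unfolding nef_params_def by (intro convex_interior convex_finite_nef_laplace nef_basis_sets)

lemma real_exp_moment_0_pos:
  assumes "t \<in> nef_params \<beta>"
  shows "real_exp_moment \<beta> 0 t > 0"
  unfolding real_exp_moment_def
  using integrable_real_exp_moment[OF nef_basis_sets assms, of 0]
  by (intro nef_basis_integral_pos[OF basis]) auto

lemma nef_log_laplace_eq:
  assumes "t \<in> nef_params \<beta>"
  shows "nef_log_laplace \<beta> t = ln (real_exp_moment \<beta> 0 t)"
  using real_exp_moment_0_pos[OF assms]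
  by (simp add: nef_log_laplace_def nef_laplace_eq[OF nef_basis_sets assms])

lemma nef_mean_eq:
  assumes "t \<in> nef_params \<beta>"
  shows "nef_mean \<beta> t = real_exp_moment \<beta> 1 t / real_exp_moment \<beta> 0 t"
proof -
  have "((\<lambda>t. ln (real_exp_moment \<beta> 0 t)) has_real_derivative
      real_exp_moment \<beta> 1 t / real_exp_moment \<beta> 0 t) (at t)"
    using DERIV_chain2[OF DERIV_ln_divide real_exp_moment_has_derivative[OF nef_basis_sets assms]]
      real_exp_moment_0_pos[OF assms] by fastforce
  then have "(nef_log_laplace \<beta> has_real_derivative
      real_exp_moment \<beta> 1 t / real_exp_moment \<beta> 0 t) (at t)"
    by (rule has_field_derivative_transform_within_open[OF _ open_nef_params assms])
       (simp add: nef_log_laplace_eq)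
  then show ?thesis
    unfolding nef_mean_def by (rule DERIV_imp_deriv)
qed

text \<open>The first form makes positivity visible; the second is what the quotient rule yields
  when the mean is differentiated.\<close>

lemma nef_member_variance:
  assumes "t \<in> nef_params \<beta>"
  defines "m \<equiv> nef_mean \<beta> t"
  shows "(LINT x|nef_member \<beta> t. (x - m)\<^sup>2)
      = (LINT x|\<beta>. (x - m)\<^sup>2 * exp (x * t)) / real_exp_moment \<beta> 0 t"
    and "(LINT x|nef_member \<beta> t. (x - m)\<^sup>2)
      = real_exp_moment \<beta> 2 t / real_exp_moment \<beta> 0 t - m\<^sup>2"
proof -
  have [measurable_cong]: "sets \<beta> = sets borel" by (rule nef_basis_sets)
  let ?g = "real_exp_moment \<beta> 0 t"
  have g: "?g > 0" by (rule real_exp_moment_0_pos[OF assms(1)])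
  have "exp (t * x - nef_log_laplace \<beta> t) = exp (x * t) / ?g" for x
    using g by (simp add: nef_log_laplace_eq[OF assms(1)] exp_diff mult.commute)
  then have "(LINT x|nef_member \<beta> t. (x - m)\<^sup>2) = (LINT x|\<beta>. (x - m)\<^sup>2 * exp (x * t) / ?g)"
    unfolding nef_member_def using g by (subst integral_real_density) (auto simp: mult.commute)
  then show eq: "(LINT x|nef_member \<beta> t. (x - m)\<^sup>2)
      = (LINT x|\<beta>. (x - m)\<^sup>2 * exp (x * t)) / ?g"
    by simp
  note int = integrable_real_exp_moment[OF nef_basis_sets assms(1)]
  have "(LINT x|\<beta>. (x - m)\<^sup>2 * exp (x * t))
      = (LINT x|\<beta>. x ^ 2 * exp (x * t) - 2 * m * (x ^ 1 * exp (x * t)) + m\<^sup>2 * (x ^ 0 * exp (x * t)))"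
    by (intro Bochner_Integration.integral_cong) (auto simp: power2_eq_square algebra_simps)
  also have "\<dots> = real_exp_moment \<beta> 2 t - 2 * m * real_exp_moment \<beta> 1 t + m\<^sup>2 * ?g"
    unfolding real_exp_moment_def using int[of 0] int[of 1] int[of 2] by simp
  also have "real_exp_moment \<beta> 1 t = m * ?g"
    using g by (simp add: m_def nef_mean_eq[OF assms(1)])
  finally have "(LINT x|\<beta>. (x - m)\<^sup>2 * exp (x * t)) = real_exp_moment \<beta> 2 t - m\<^sup>2 * ?g"
    by (simp add: power2_eq_square)
  then show "(LINT x|nef_member \<beta> t. (x - m)\<^sup>2) = real_exp_moment \<beta> 2 t / ?g - m\<^sup>2"
    unfolding eq using g by (simp add: diff_divide_distrib)
qed

lemma nef_member_variance_pos:
  assumes "t \<in> nef_params \<beta>"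
  shows "(LINT x|nef_member \<beta> t. (x - nef_mean \<beta> t)\<^sup>2) > 0"
proof -
  let ?m = "nef_mean \<beta> t"
  note int = integrable_real_exp_moment[OF nef_basis_sets assms(1)]
  have "integrable \<beta> (\<lambda>x. x ^ 2 * exp (x * t) - 2 * ?m * (x ^ 1 * exp (x * t))
      + ?m\<^sup>2 * (x ^ 0 * exp (x * t)))"
    using int[of 0] int[of 1] int[of 2] by simp
  also have "(\<lambda>x. x ^ 2 * exp (x * t) - 2 * ?m * (x ^ 1 * exp (x * t))
      + ?m\<^sup>2 * (x ^ 0 * exp (x * t))) = (\<lambda>x. (x - ?m)\<^sup>2 * exp (x * t))"
    by (auto simp: power2_eq_square algebra_simps)
  finally have "(LINT x|\<beta>. (x - ?m)\<^sup>2 * exp (x * t)) > 0"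
    by (rule nef_basis_integral_pos[OF basis, where c = ?m]) auto
  then show ?thesis
    using real_exp_moment_0_pos[OF assms] by (simp add: nef_member_variance(1)[OF assms])
qed

lemma nef_mean_has_derivative_member_variance:
  assumes "t \<in> nef_params \<beta>"
  shows "(nef_mean \<beta> has_real_derivative
      (LINT x|nef_member \<beta> t. (x - nef_mean \<beta> t)\<^sup>2)) (at t)"
proof -
  let ?g = "real_exp_moment \<beta>"
  have g: "?g 0 t > 0" by (rule real_exp_moment_0_pos[OF assms])
  note deriv = real_exp_moment_has_derivative[OF nef_basis_sets assms]
  have "((\<lambda>t. ?g 1 t / ?g 0 t) has_real_derivative
      (?g 2 t * ?g 0 t - ?g 1 t * ?g 1 t) / (?g 0 t * ?g 0 t)) (at t)"
    using DERIV_divide[OF deriv[of 1] deriv[of 0]] g by (simp add: numeral_2_eq_2)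
  also have "(?g 2 t * ?g 0 t - ?g 1 t * ?g 1 t) / (?g 0 t * ?g 0 t)
      = ?g 2 t / ?g 0 t - (?g 1 t / ?g 0 t)\<^sup>2"
    using g by (simp add: field_simps power2_eq_square)
  finally have "((\<lambda>t. ?g 1 t / ?g 0 t) has_real_derivative
      ?g 2 t / ?g 0 t - (?g 1 t / ?g 0 t)\<^sup>2) (at t)" .
  then have "(nef_mean \<beta> has_real_derivative
      ?g 2 t / ?g 0 t - (?g 1 t / ?g 0 t)\<^sup>2) (at t)"
    by (rule has_field_derivative_transform_within_open[OF _ open_nef_params assms])
       (simp add: nef_mean_eq)
  then show ?thesis
    using nef_member_variance(2)[OF assms] nef_mean_eq[OF assms] by simp
qed

text \<open>The derivative of the mean is a variance, hence positive, and the parameter set is an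
  interval. Injectivity makes \<open>nef_param_of_mean\<close> a true inverse.\<close>

lemma inj_on_nef_mean: "inj_on (nef_mean \<beta>) (nef_params \<beta>)"
proof (rule linorder_inj_onI')
  fix s t assume st: "s \<in> nef_params \<beta>" "t \<in> nef_params \<beta>" "s < t"
  have "nef_mean \<beta> s < nef_mean \<beta> t"
  proof (rule DERIV_pos_imp_increasing[OF st(3)])
    fix x assume "s \<le> x" "x \<le> t"
    then have "x \<in> closed_segment s t"
      using st(3) by (auto simp: closed_segment_eq_real_ivl)
    then have "x \<in> nef_params \<beta>"
      using convex_nef_params st(1,2) by (auto simp: convex_contains_segment)
    then show "\<exists>y. (nef_mean \<beta> has_real_derivative y) (at x) \<and> y > 0"
      using nef_mean_has_derivative_member_variance nef_member_variance_pos by blast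
  qed
  then show "nef_mean \<beta> s \<noteq> nef_mean \<beta> t" by simp
qed

lemma nef_mean_has_derivative:
  assumes "t \<in> nef_params \<beta>"
  shows "(nef_mean \<beta> has_real_derivative nef_variance \<beta> (nef_mean \<beta> t)) (at t)"
  using nef_mean_has_derivative_member_variance[OF assms] assms
  by (simp add: nef_variance_def nef_param_of_mean_def inv_into_f_f[OF inj_on_nef_mean])

end

section \<open>Two tools from complex analysis\<close>

text \<open>The singularity at \<open>a\<close> is removable, with value \<open>deriv f a\<close>,
  and holomorphic functions on convex open sets have primitives.\<close>

lemma ex_primitive_difference_quotient:
  assumes "convex S" "open S" "f holomorphic_on S"
  obtains H where "H holomorphic_on S"
    "\<And>z. z \<in> S - {a} \<Longrightarrow> (H has_field_derivative (f z - f a) / (z - a)) (at z)"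
proof -
  let ?q = "\<lambda>z. if z = a then deriv f a else (f z - f a) / (z - a)"
  have q: "?q holomorphic_on S"
    by (rule pole_lemma_open[OF assms(3,2)])
  obtain H where H: "\<And>z. z \<in> S \<Longrightarrow> (H has_field_derivative ?q z) (at z within S)"
    using holomorphic_convex_primitive'[OF assms(1,2) q] by blast
  show ?thesis
  proof (rule that)
    show "H holomorphic_on S"
      unfolding holomorphic_on_def field_differentiable_def using H by blast
    show "(H has_field_derivative (f z - f a) / (z - a)) (at z)" if "z \<in> S - {a}" for z
      using H[of z] that assms(2) by (simp add: at_within_open[of z S])
  qed
qed

text \<open>Near a zero of order k write f(w) = (w - a)^k g(w) with g nonvanishing; then (w - a)
  f'(w) / f(w) = k + (w - a) g'(w) / g(w). The approach to \<open>a\<close> is along an arbitrary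
  filter, so that it can be parametrised by a real variable tending to infinity.\<close>

lemma log_derivative_tendsto_order:
  fixes f :: "complex \<Rightarrow> complex" and X :: "'a \<Rightarrow> complex"
  assumes "f holomorphic_on S" "open S" "connected S" "\<not> f constant_on S"
    and "a \<in> S" "f a = 0"
    and X: "(X \<longlongrightarrow> a) F" "\<forall>\<^sub>F x in F. X x \<noteq> a"
  obtains k :: nat where "k > 0" "((\<lambda>x. (X x - a) * deriv f (X x) / f (X x)) \<longlongrightarrow> of_nat k) F"
proof -
  obtain g r k where g: "k > 0" "r > 0" "ball a r \<subseteq> S" "g holomorphic_on ball a r"
    "\<And>w. w \<in> ball a r \<Longrightarrow> f w = (w - a) ^ k * g w" "\<And>w. w \<in> ball a r \<Longrightarrow> g w \<noteq> 0"
    using holomorphic_factor_zero_nonconstant[OF assms(1-3,5,6,4)] by metis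
  have "\<forall>\<^sub>F x in F. X x \<in> ball a r"
    using X(1) g(2) by (intro topological_tendstoD) auto
  then have "\<forall>\<^sub>F x in F. of_nat k + (X x - a) * deriv g (X x) / g (X x)
      = (X x - a) * deriv f (X x) / f (X x)"
    using X(2)
  proof eventually_elim
    case (elim x)
    let ?w = "X x"
    have "(g has_field_derivative deriv g ?w) (at ?w)"
      using g(4) elim by (intro holomorphic_derivI[of _ "ball a r"]) auto
    then have "((\<lambda>w. (w - a) ^ k * g w) has_field_derivative
        (of_nat k * (?w - a) ^ (k - 1) * g ?w + (?w - a) ^ k * deriv g ?w)) (at ?w)"
      by (auto intro!: derivative_eq_intros simp: algebra_simps)
    then have "(f has_field_derivative
        (of_nat k * (?w - a) ^ (k - 1) * g ?w + (?w - a) ^ k * deriv g ?w)) (at ?w)"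
      by (rule has_field_derivative_transform_within_open[of _ _ _ "ball a r"]) (use elim g(5) in auto)
    then have "deriv f ?w = of_nat k * (?w - a) ^ (k - 1) * g ?w + (?w - a) ^ k * deriv g ?w"
      by (rule DERIV_imp_deriv)
    \<comment> \<open>This removes the truncated subtraction in the exponent
      \<open>k - 1\<close>.\<close>
    moreover obtain j where "k = Suc j"
      using g(1) not0_implies_Suc by blast
    ultimately have "deriv f ?w = (?w - a) ^ j * (of_nat k * g ?w + (?w - a) * deriv g ?w)"
      "f ?w = (?w - a) * (?w - a) ^ j * g ?w" "?w - a \<noteq> 0" "g ?w \<noteq> 0"
      using elim g(5,6)[of ?w] by (simp_all add: algebra_simps)
    moreover have "K + e * g' / y = e * D / y'"
      if "D = q * (K * y + e * g')" "y' = e * q * y" "e \<noteq> 0" "y \<noteq> 0" "q \<noteq> 0"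
      for D K e g' q y y' :: complex
      using that by (simp add: field_simps)
    ultimately show ?case
      by (metis power_not_zero)
  qed
  moreover have "((\<lambda>x. of_nat k + (X x - a) * deriv g (X x) / g (X x)) \<longlongrightarrow>
      of_nat k + (a - a) * deriv g a / g a) F"
  proof -
    have "isCont g a" "isCont (deriv g) a"
      using g(2) holomorphic_on_imp_continuous_on[OF g(4)]
        holomorphic_on_imp_continuous_on[OF holomorphic_deriv[OF g(4) open_ball]]
      by (simp_all add: continuous_on_eq_continuous_at)
    then show ?thesis
      using g(2) g(6)[of a] X(1)
      by (intro tendsto_intros isCont_tendsto_compose[of a g] isCont_tendsto_compose[of a "deriv g"])
         auto
  qed
  ultimately show ?thesis
    using that[OF g(1)] by (simp add: tendsto_cong)
qed

section \<open>The variance polynomial and the canonical parameter\<close>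

locale variance_polynomial =
  fixes a0 \<alpha> \<gamma> :: real and n :: nat
  assumes a0: "a0 > 0" and \<gamma>: "\<gamma> > 0"
begin

text \<open>This is v(x)/x, where \<alpha> and \<gamma> are the real and imaginary part of
  u1.\<close>

definition pr :: "real \<Rightarrow> real" where "pr x = a0 * ((x - \<alpha>)\<^sup>2 + \<gamma>\<^sup>2) ^ n"

definition p :: "complex \<Rightarrow> complex" where
  "p z = of_real a0 * ((z - of_real \<alpha>)\<^sup>2 + of_real (\<gamma>\<^sup>2)) ^ n"

text \<open>An open strip around the real axis that avoids the points u1 and its conjugate, which
  lie on its boundary. Its convexity provides primitives.\<close>

definition S :: "complex set" where "S = {z. \<bar>Im z\<bar> < \<gamma>}"

lemma p_of_real: "p (of_real x) = of_real (pr x)"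
  by (simp add: p_def pr_def)

lemma pr_pos: "pr x > 0"
  using a0 \<gamma> by (simp add: pr_def add_nonneg_pos)

lemma p_nonzero:
  assumes "z \<in> S"
  shows "p z \<noteq> 0"
proof -
  have "(z - of_real \<alpha>)\<^sup>2 + of_real (\<gamma>\<^sup>2)
      = (z - of_real \<alpha> - \<i> * of_real \<gamma>) * (z - of_real \<alpha> + \<i> * of_real \<gamma>)"
    by (simp add: algebra_simps power2_eq_square)
  moreover have "z - of_real \<alpha> - \<i> * of_real \<gamma> \<noteq> 0" "z - of_real \<alpha> + \<i> * of_real \<gamma> \<noteq> 0"
    using assms by (auto simp: S_def complex_eq_iff)
  ultimately show ?thesis
    using a0 by (simp add: p_def)
qed

lemma of_real_in_S: "of_real x \<in> S"
  using \<gamma> by (simp add: S_def)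

lemma S_eq: "S = {z. Im z < \<gamma>} \<inter> {z. - \<gamma> < Im z}"
  by (auto simp: S_def)

lemma open_S: "open S"
  unfolding S_eq by (intro open_Int open_halfspace_Im_lt open_halfspace_Im_gt)

lemma convex_S: "convex S"
  unfolding S_eq
  using convex_halfspace_Im_lt[of \<gamma>] convex_halfspace_Im_gt[of "- \<gamma>"] by (auto intro: convex_Int)

text \<open>Removing the polar part 1/(p(0) z) from 1/(z p(z)) leaves a function that extends
  holomorphically over 0.\<close>

lemma ex_regular_part:
  obtains H where "H holomorphic_on S"
    "\<And>z. z \<in> S - {0} \<Longrightarrow> (H has_field_derivative (1 / p z - 1 / p 0) / z) (at z)"
proof -
  have "(\<lambda>z. 1 / p z) holomorphic_on S"
    using p_nonzero unfolding p_def by (intro holomorphic_intros) (auto simp: p_def)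
  from ex_primitive_difference_quotient[OF convex_S open_S this, of 0] show ?thesis
    using that by auto
qed

end

text \<open>\<open>\<theta> w\<close> is the canonical parameter as a function of the logarithm \<open>w\<close> of the mean: a primitive of
  \<open>1 / v(u)\<close> splits into \<open>ln u / p 0\<close> and a part \<open>H\<close> that is regular at \<open>0\<close>.\<close>

locale canonical_parameter = variance_polynomial +
  fixes H :: "complex \<Rightarrow> complex" and c :: complex
  assumes H: "H holomorphic_on S"
      "\<And>z. z \<in> S - {0} \<Longrightarrow> (H has_field_derivative (1 / p z - 1 / p 0) / z) (at z)"
begin

definition \<theta> :: "complex \<Rightarrow> complex" where "\<theta> w = w / of_real (pr 0) + H (exp w) - c"

lemma exp_line: "exp (of_real w) = (of_real (exp w) :: complex)"
  "exp (of_real w + \<i> * of_real pi) = (of_real (- exp w) :: complex)"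
  by (simp_all add: exp_of_real exp_add exp_pi_i)

text \<open>With u = exp w, the chain rule turns 1/v(u) = 1/(u p(u)) into 1/p(u): the pole at u = 0
  disappears in the logarithmic variable.\<close>

lemma \<theta>_deriv:
  assumes "exp w \<in> S"
  shows "(\<theta> has_field_derivative 1 / p (exp w)) (at w)"
proof -
  have "((\<lambda>w. H (exp w)) has_field_derivative (1 / p (exp w) - 1 / p 0) / exp w * exp w) (at w)"
    using assms by (intro DERIV_chain2[OF H(2)]) auto
  then have "(\<theta> has_field_derivative
      1 / of_real (pr 0) + (1 / p (exp w) - 1 / p 0) / exp w * exp w - 0) (at w)"
    unfolding \<theta>_def[abs_def] using pr_pos[of 0]
    by (intro derivative_intros) (auto intro!: derivative_eq_intros)
  then show ?thesis
    using p_of_real[of 0] by simp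
qed

end

section \<open>Continuation to negative means and the contradiction\<close>

text \<open>\<open>T\<close> stands for the interval of canonical parameters and \<open>G\<close>
  for the Laplace transform. The assumptions collect what a family with positive \<alpha> would
  provide, and are refuted in \<open>inconsistent\<close>.\<close>

locale negative_axis_continuation = canonical_parameter +
  fixes T :: "real set" and G :: "complex \<Rightarrow> complex"
  assumes \<alpha>: "\<alpha> > 0" and n: "n \<ge> 1"
    and T: "open T" "convex T"
    and G: "G holomorphic_on {z. Re z \<in> T}" "\<And>t. t \<in> T \<Longrightarrow> G (of_real t) \<noteq> 0"
    and \<theta>_real: "\<And>w::real. \<exists>t\<in>T. \<theta> (of_real w) = of_real t"
    and ode: "\<And>w::real. deriv G (\<theta> (of_real w)) = of_real (exp w) * G (\<theta> (of_real w))"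
begin

text \<open>\<sigma> belongs to the mean \<open>exp w\<close>. \<rho> belongs to the continued mean
  \<open>- exp w\<close>, reached by a half-turn around 0 that adds i pi to the logarithm;
  \<open>y0\<close> is the height of the line on which the parameter then moves.\<close>

definition \<sigma> :: "real \<Rightarrow> real" where "\<sigma> w = Re (\<theta> (of_real w))"
definition \<rho> :: "real \<Rightarrow> real" where "\<rho> w = Re (\<theta> (of_real w + \<i> * of_real pi))"
definition y0 :: real where "y0 = Im (\<theta> (\<i> * of_real pi))"

lemma \<sigma>_in_T: "\<sigma> w \<in> T"
  using \<theta>_real[of w] by (auto simp: \<sigma>_def)

lemma \<sigma>_deriv: "(\<sigma> has_real_derivative 1 / pr (exp w)) (at w)"
proof -
  have "((\<lambda>w. \<theta> (of_real w)) has_vector_derivative 1 / p (of_real (exp w))) (at w)"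
    using \<theta>_deriv[of "of_real w"] of_real_in_S[of "exp w"]
    by (intro has_vector_derivative_real_field) (simp add: exp_line)
  from has_field_derivative_Re[OF this] show ?thesis
    by (simp add: \<sigma>_def[abs_def] p_of_real)
qed

lemma \<theta>_neg_deriv:
  "((\<lambda>w. \<theta> (of_real w + \<i> * of_real pi)) has_vector_derivative of_real (1 / pr (- exp w))) (at w)"
proof -
  have "(\<theta> has_field_derivative of_real (1 / pr (- exp w))) (at (of_real w + \<i> * of_real pi))"
    using \<theta>_deriv[of "of_real w + \<i> * of_real pi"] of_real_in_S[of "- exp w"]
    unfolding exp_line p_of_real by simp
  then have "((\<lambda>z. \<theta> (z + \<i> * of_real pi)) has_field_derivative of_real (1 / pr (- exp w)))
      (at (of_real w))"
    by (simp add: DERIV_shift)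
  then show ?thesis
    by (rule has_vector_derivative_real_field)
qed

lemma \<rho>_deriv: "(\<rho> has_real_derivative 1 / pr (- exp w)) (at w)"
  using has_field_derivative_Re[OF \<theta>_neg_deriv[of w]] by (simp add: \<rho>_def[abs_def])

text \<open>The derivative along this line is real, so the imaginary part stays constant.\<close>

lemma \<theta>_neg: "\<theta> (of_real w + \<i> * of_real pi) = Complex (\<rho> w) y0"
proof -
  have "((\<lambda>w. Im (\<theta> (of_real w + \<i> * of_real pi))) has_real_derivative 0) (at w)" for w
    using has_field_derivative_Im[OF \<theta>_neg_deriv[of w]] by simp
  then have "Im (\<theta> (of_real w + \<i> * of_real pi)) = Im (\<theta> (of_real 0 + \<i> * of_real pi))"
    using DERIV_isconst_all[of "\<lambda>w. Im (\<theta> (of_real w + \<i> * of_real pi))" w 0] by blast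
  then show ?thesis
    by (simp add: complex_eq_iff \<rho>_def y0_def)
qed

lemma \<rho>_strict_mono: "w < w' \<Longrightarrow> \<rho> w < \<rho> w'"
  by (rule DERIV_pos_imp_increasing[of w w' \<rho>])
     (use \<rho>_deriv pr_pos in \<open>auto intro!: exI\<close>)

lemma isCont_H_0: "isCont H 0"
  using H(1) open_S of_real_in_S[of 0]
  by (metis continuous_on_eq_continuous_at holomorphic_on_imp_continuous_on of_real_0)

lemma exp_tendsto_0_at_bot: "((\<lambda>w. of_real (exp w) :: complex) \<longlongrightarrow> 0) at_bot"
  using tendsto_of_real[OF exp_at_bot] by simp

text \<open>For \<open>\<alpha> > 0\<close> the polynomial is smaller on the positive than on the negative half-axis,
  so the parameter travels farther along the former.\<close>

lemma \<sigma>_minus_\<rho>_deriv_pos: "\<exists>y. ((\<lambda>w. \<sigma> w - \<rho> w) has_real_derivative y) (at x) \<and> y > 0"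
proof -
  have "(exp x - \<alpha>)\<^sup>2 < (- exp x - \<alpha>)\<^sup>2"
    using \<alpha> by (simp add: power2_eq_square algebra_simps)
  then have "pr (exp x) < pr (- exp x)"
    unfolding pr_def using a0 n by (intro mult_strict_left_mono power_strict_mono) auto
  then have "1 / pr (exp x) - 1 / pr (- exp x) > 0"
    using pr_pos[of "exp x"] by (simp add: divide_strict_left_mono)
  then show ?thesis
    using DERIV_diff[OF \<sigma>_deriv \<rho>_deriv] by blast
qed

lemma \<sigma>_minus_\<rho>_mono: "w \<le> w' \<Longrightarrow> \<sigma> w - \<rho> w \<le> \<sigma> w' - \<rho> w'"
  using DERIV_nonneg_imp_nondecreasing[of w w' "\<lambda>w. \<sigma> w - \<rho> w"] \<sigma>_minus_\<rho>_deriv_pos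
  by (meson less_imp_le)

text \<open>The difference is increasing and tends to 0 at \<open>at_bot\<close>: the terms linear
  in \<open>w\<close> have equal real parts, and both values of \<open>H\<close> tend to
  \<open>H 0\<close>.\<close>

lemma \<rho>_less_\<sigma>: "\<rho> w < \<sigma> w"
proof -
  have "0 < \<sigma> w - \<rho> w"
  proof (rule DERIV_pos_imp_increasing_at_bot[where f = "\<lambda>w. \<sigma> w - \<rho> w"])
    show "\<exists>y. ((\<lambda>w. \<sigma> w - \<rho> w) has_real_derivative y) (at x) \<and> y > 0" for x
      by (rule \<sigma>_minus_\<rho>_deriv_pos)
    have "((\<lambda>w. Re (H (of_real (exp w)) - H (- of_real (exp w)))) \<longlongrightarrow> Re (H 0 - H (- 0))) at_bot"
      using isCont_H_0 exp_tendsto_0_at_bot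
      by (intro tendsto_intros isCont_tendsto_compose[of _ H]) (auto intro: tendsto_eq_intros)
    also have "(\<lambda>w. Re (H (of_real (exp w)) - H (- of_real (exp w)))) = (\<lambda>w. \<sigma> w - \<rho> w)"
      by (auto simp: \<sigma>_def \<rho>_def \<theta>_def exp_line add_divide_distrib)
    finally show "((\<lambda>w. \<sigma> w - \<rho> w) \<longlongrightarrow> 0) at_bot"
      by simp
  qed
  then show ?thesis by simp
qed

text \<open>For u = exp w near 0 the regular part is within distance 1 of \<open>H 0\<close>, so the
  logarithmic term governs \<open>Re (\<theta> w)\<close>.\<close>

lemma Re_\<theta>_bound:
  obtains L B where "\<And>w. Re w < L \<Longrightarrow> exp w \<in> S \<and> Re (\<theta> w) \<le> Re w / pr 0 + B"
proof -
  obtain d where d: "d > 0" "\<And>z. norm z < d \<Longrightarrow> norm (H z - H 0) < 1"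
    using isCont_H_0 unfolding continuous_at_eps_delta
    by (metis dist_0_norm dist_commute dist_norm zero_less_one)
  show ?thesis
  \<comment> \<open>The bound \<open>d\<close> controls \<open>H\<close>, while \<gamma> keeps
    \<open>exp w\<close> in the strip \<open>S\<close>.\<close>
  proof (rule that[of "ln (min d \<gamma>)" "Re (H 0) + 1 - Re c"])
    fix w :: complex
    assume w: "Re w < ln (min d \<gamma>)"
    have "norm (exp w) < min d \<gamma>"
      using w d(1) \<gamma> by (metis exp_less_mono exp_ln min_less_iff_conj norm_exp_eq_Re)
    moreover have "\<bar>Im (exp w)\<bar> \<le> norm (exp w)"
      by (rule abs_Im_le_cmod)
    moreover have "Re (H (exp w)) - Re (H 0) \<le> norm (H (exp w) - H 0)"
      using complex_Re_le_cmod[of "H (exp w) - H 0"] by simp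
    ultimately show "exp w \<in> S \<and> Re (\<theta> w) \<le> Re w / pr 0 + (Re (H 0) + 1 - Re c)"
      using d(2)[of "exp w"] by (auto simp: \<theta>_def S_def)
  qed
qed

lemma T_unbounded_below: "\<exists>w. \<sigma> w < s"
proof -
  obtain L B where LB: "\<And>w. Re w < L \<Longrightarrow> exp w \<in> S \<and> Re (\<theta> w) \<le> Re w / pr 0 + B"
    using Re_\<theta>_bound by blast
  define w where "w = min (L - 1) ((s - B - 1) * pr 0)"
  have "w / pr 0 \<le> s - B - 1"
    using pr_pos[of 0] by (simp add: w_def pos_divide_le_eq)
  moreover have "\<sigma> w \<le> w / pr 0 + B"
    using LB[of "of_real w"] by (simp add: \<sigma>_def w_def)
  ultimately show ?thesis
    by (intro exI[of _ w]) simp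
qed

text \<open>\<open>T\<close> is an interval unbounded below. Hence any point to the left of some
  \<open>\<sigma> w\<close> lies in \<open>T\<close>, and comparison with \<sigma> is all that
  membership requires.\<close>

lemma T_downward:
  assumes "s \<le> t" "t \<in> T"
  shows "s \<in> T"
proof -
  obtain w where "\<sigma> w < s"
    using T_unbounded_below by blast
  then have "s \<in> closed_segment (\<sigma> w) t"
    using assms(1) by (auto simp: closed_segment_eq_real_ivl)
  then show ?thesis
    using T(2) \<sigma>_in_T[of w] assms(2) by (auto simp: convex_contains_segment)
qed

lemma open_strip: "open {z. Re z \<in> T}"
  using open_vimage[OF T(1) continuous_on_Re[OF continuous_on_id]] by (simp add: vimage_def)

lemma \<theta>_holomorphic: "\<theta> holomorphic_on {w. exp w \<in> S}"
  unfolding holomorphic_on_def field_differentiable_def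
  using \<theta>_deriv has_field_derivative_at_within by blast

text \<open>In the logarithmic variable \<open>w\<close>, the half-plane near \<open>Re w = -\<infinity>\<close> joins the real line,
  where the equation is known, to the line \<open>Im w = \<pi>\<close>, i.e. to the negative mean values.\<close>

lemma ode_neg: "deriv G (Complex (\<rho> w) y0) = - of_real (exp w) * G (Complex (\<rho> w) y0)"
proof -
  \<comment> \<open>Here \<theta> is holomorphic and maps into the strip on which \<open>G\<close>
    is.\<close>
  define \<Omega> where "\<Omega> = {w. exp w \<in> S} \<inter> \<theta> -` {z. Re z \<in> T}"
  have "open (exp -` S :: complex set)"
    by (intro open_vimage open_S continuous_intros)
  then have opS: "open {w. exp w \<in> S}"
    by (simp add: vimage_def)
  have open_\<Omega>: "open \<Omega>"
    unfolding \<Omega>_def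
    by (intro continuous_open_preimage holomorphic_on_imp_continuous_on \<theta>_holomorphic open_strip opS)
  let ?E = "\<lambda>w. deriv G (\<theta> w) - exp w * G (\<theta> w)"
  have \<theta>_\<Omega>: "\<theta> holomorphic_on \<Omega>"
    using \<theta>_holomorphic by (rule holomorphic_on_subset) (auto simp: \<Omega>_def)
  have "\<theta> ` \<Omega> \<subseteq> {z. Re z \<in> T}"
    by (auto simp: \<Omega>_def)
  then have "(G \<circ> \<theta>) holomorphic_on \<Omega>" "(deriv G \<circ> \<theta>) holomorphic_on \<Omega>"
    using holomorphic_on_compose_gen[OF \<theta>_\<Omega>] G(1) holomorphic_deriv[OF G(1) open_strip]
    by blast+
  then have E: "?E holomorphic_on \<Omega>"
    by (auto intro!: holomorphic_intros simp: o_def)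
  obtain L B where LB: "\<And>w. Re w < L \<Longrightarrow> exp w \<in> S \<and> Re (\<theta> w) \<le> Re w / pr 0 + B"
    using Re_\<theta>_bound by blast
  \<comment> \<open>Left of this threshold the bound gives
    \<open>Re (\<theta> w) \<le> \<sigma> 0\<close>, and \<open>\<sigma> 0\<close> lies in
    \<open>T\<close>.\<close>
  define L' where "L' = min L ((\<sigma> 0 - B) * pr 0)"
  define P where "P = {w. Re w < L'}"
  define l where "l = {w. Im w = pi}"
  have P: "P \<subseteq> \<Omega>"
  proof
    fix w assume "w \<in> P"
    then have "Re w < L" "Re w / pr 0 \<le> \<sigma> 0 - B"
      using pr_pos[of 0] by (auto simp: P_def L'_def pos_divide_le_eq)
    then have "exp w \<in> S" "Re (\<theta> w) \<le> \<sigma> 0"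
      using LB[of w] by auto
    then show "w \<in> \<Omega>"
      using T_downward[OF _ \<sigma>_in_T] by (auto simp: \<Omega>_def)
  qed
  have l_eq: "w = of_real (Re w) + \<i> * of_real pi" if "w \<in> l" for w
    using that by (auto simp: l_def complex_eq_iff)
  have l: "l \<subseteq> \<Omega>"
  proof
    fix w assume w: "w \<in> l"
    have "exp w \<in> S" "\<theta> w = Complex (\<rho> (Re w)) y0"
      using l_eq[OF w] exp_line(2)[of "Re w"] of_real_in_S \<theta>_neg by metis+
    then show "w \<in> \<Omega>"
      using T_downward[OF less_imp_le[OF \<rho>_less_\<sigma>] \<sigma>_in_T] by (auto simp: \<Omega>_def)
  qed
  define b where "b = of_real (L' - 1) + \<i> * of_real pi"
  have b: "b \<in> P \<inter> l"
    by (simp add: P_def l_def b_def)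
  have "connected (P \<union> l)"
  proof (rule connected_Un)
    show "connected P" "connected l"
      unfolding P_def l_def
      by (auto intro!: convex_connected convex_halfspace_Re_lt simp: convex_alt algebra_simps)
    show "P \<inter> l \<noteq> {}"
      using b by blast
  qed
  \<comment> \<open>The identity theorem needs an open connected domain, so the component of
    \<Omega> containing both the half-plane and the line is used.\<close>
  define C where "C = connected_component_set \<Omega> b"
  have C: "P \<union> l \<subseteq> C"
    unfolding C_def using \<open>connected (P \<union> l)\<close> P l b by (intro connected_component_maximal) auto
  have E_0: "?E (of_real w + \<i> * of_real pi) = 0"
  proof (rule analytic_continuation[where f = ?E])
    show "?E holomorphic_on C"
      using E by (rule holomorphic_on_subset) (auto simp: C_def connected_component_subset)
    show "open C" "connected C"
      unfolding C_def using open_\<Omega> by (auto intro: open_connected_component)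
    show "P \<inter> \<real> \<subseteq> C" "of_real (L' - 1) \<in> C" "of_real w + \<i> * of_real pi \<in> C"
      using C by (auto simp: P_def l_def)
    \<comment> \<open>The real points of the half-plane, where the equation is known, accumulate
      inside \<open>C\<close>.\<close>
    show "of_real (L' - 1) islimpt P \<inter> \<real>"
      unfolding islimpt_approachable
    proof (intro allI impI)
      fix e :: real assume "e > 0"
      then show "\<exists>x'\<in>P \<inter> \<real>. x' \<noteq> of_real (L' - 1) \<and> dist x' (of_real (L' - 1)) < e"
        by (intro bexI[of _ "of_real (L' - 1 - e / 2)"])
           (auto simp: P_def dist_norm norm_of_real simp flip: of_real_diff)
    qed
    show "?E z = 0" if "z \<in> P \<inter> \<real>" for z
      using that ode by (auto elim!: Reals_cases simp: exp_line)
  qed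
  show ?thesis
    using E_0 by (simp add: \<theta>_neg exp_line add_eq_0_iff2)
qed

text \<open>The derivative of \<rho> is at most \<open>exp (- 2 * w) / a0\<close>, and the added
  term is the tail integral of this bound. The base of the power is at least 1 for
  \<open>w \<ge> 0\<close>, so exponent 1 gives a lower bound for every \<open>n\<close>.\<close>

lemma \<rho>_rate: "0 \<le> w \<Longrightarrow> w \<le> w' \<Longrightarrow> \<rho> w' + exp (- 2 * w') / (2 * a0) \<le> \<rho> w + exp (- 2 * w) / (2 * a0)"
proof -
  assume w: "0 \<le> w" "w \<le> w'"
  show ?thesis
  proof (rule DERIV_nonpos_imp_nonincreasing[OF w(2)])
    fix x assume x: "w \<le> x" "x \<le> w'"
    have "(exp x)\<^sup>2 \<le> (- exp x - \<alpha>)\<^sup>2 + \<gamma>\<^sup>2"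
      using \<alpha> by (simp add: power2_eq_square algebra_simps)
    moreover have "((- exp x - \<alpha>)\<^sup>2 + \<gamma>\<^sup>2) ^ 1 \<le> ((- exp x - \<alpha>)\<^sup>2 + \<gamma>\<^sup>2) ^ n"
    proof (rule power_increasing[OF n])
      have "1 \<le> (exp x)\<^sup>2" using x w by (simp add: one_le_power)
      with calculation show "1 \<le> (- exp x - \<alpha>)\<^sup>2 + \<gamma>\<^sup>2" by linarith
    qed
    ultimately have "a0 * (exp x)\<^sup>2 \<le> pr (- exp x)"
      unfolding pr_def using a0 by (intro mult_left_mono) auto
    then have "1 / pr (- exp x) \<le> 1 / (a0 * (exp x)\<^sup>2)"
      using a0 by (intro divide_left_mono mult_pos_pos pr_pos) auto
    also have "\<dots> = exp (- 2 * x) / a0"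
      by (simp add: exp_minus field_simps flip: exp_double)
    finally have "1 / pr (- exp x) + - exp (- 2 * x) / a0 \<le> 0" by simp
    moreover have "((\<lambda>w. \<rho> w + exp (- 2 * w) / (2 * a0)) has_real_derivative
        1 / pr (- exp x) + - exp (- 2 * x) / a0) (at x)"
      using a0 by (auto intro!: derivative_eq_intros \<rho>_deriv simp: field_simps)
    ultimately show "\<exists>y. ((\<lambda>w. \<rho> w + exp (- 2 * w) / (2 * a0)) has_real_derivative y) (at x) \<and> y \<le> 0"
      by blast
  qed
qed

lemma inconsistent: False
proof -
  have bdd: "bdd_above (range \<rho>)"
  proof (rule bdd_aboveI2)
    fix w
    have "\<rho> w \<le> \<rho> (max 0 w)"
      using \<rho>_strict_mono[of w "max 0 w"] by (cases "w < 0") auto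
    also have "\<dots> \<le> \<rho> 0 + 1 / (2 * a0)"
      using \<rho>_rate[of 0 "max 0 w"] a0
      by (smt (verit) divide_nonneg_pos exp_ge_zero exp_zero max.cobounded1 mult_zero_right)
    finally show "\<rho> w \<le> \<rho> 0 + 1 / (2 * a0)" .
  qed
  define \<tau> where "\<tau> = (SUP w. \<rho> w)"
  have mono: "mono \<rho>"
    using \<rho>_strict_mono by (intro strict_mono_mono strict_monoI)
  have less_\<tau>: "\<rho> w < \<tau>" for w
    using \<rho>_strict_mono[of w "w + 1"] cSUP_upper[OF _ bdd, of "w + 1"] by (simp add: \<tau>_def)
  have rate: "\<tau> \<le> \<rho> w + exp (- 2 * w) / (2 * a0)" if "w \<ge> 0" for w
    unfolding \<tau>_def
  proof (rule cSUP_least)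
    fix w' :: real
    have "\<rho> w' \<le> \<rho> (max w w')"
      using mono by (auto simp: mono_def)
    also have "\<dots> \<le> \<rho> (max w w') + exp (- 2 * max w w') / (2 * a0)"
      using a0 by simp
    also have "\<dots> \<le> \<rho> w + exp (- 2 * w) / (2 * a0)"
      using that by (intro \<rho>_rate) auto
    finally show "\<rho> w' \<le> \<rho> w + exp (- 2 * w) / (2 * a0)" .
  qed simp
  have \<tau>_lim: "(\<rho> \<longlongrightarrow> \<tau>) at_top"
  proof (rule tendsto_sandwich)
    show "((\<lambda>w. \<tau> - exp (- 2 * w) / (2 * a0)) \<longlongrightarrow> \<tau>) at_top"
      using a0 by real_asymp
    show "\<forall>\<^sub>F w in at_top. \<tau> - exp (- 2 * w) / (2 * a0) \<le> \<rho> w"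
      using eventually_ge_at_top[of 0] by eventually_elim (use rate in force)
    show "\<forall>\<^sub>F w in at_top. \<rho> w \<le> \<tau>"
      using less_\<tau> by (auto intro: always_eventually less_imp_le)
  qed auto
  \<comment> \<open>For \<open>w \<ge> 0\<close> the gap between \<sigma> and \<rho> stays at least
    \<delta>, whereas \<rho> comes arbitrarily close to \<tau>; so \<sigma> eventually passes
    \<tau>.\<close>
  have "\<tau> \<in> T"
  proof -
    define \<delta> where "\<delta> = \<sigma> 0 - \<rho> 0"
    have "\<delta> > 0"
      using \<rho>_less_\<sigma>[of 0] by (simp add: \<delta>_def)
    have gap: "\<delta> \<le> \<sigma> w - \<rho> w" if "w \<ge> 0" for w
      unfolding \<delta>_def
      using \<sigma>_minus_\<rho>_mono[OF that] .
    have "((\<lambda>w. exp (- 2 * w) / (2 * a0)) \<longlongrightarrow> 0) at_top"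
      using a0 by real_asymp
    then have "\<forall>\<^sub>F w in at_top. exp (- 2 * w) / (2 * a0) < \<delta>"
      using \<open>\<delta> > 0\<close> by (rule order_tendstoD)
    then have "\<forall>\<^sub>F w in at_top. \<tau> \<le> \<sigma> w"
      using eventually_ge_at_top[of 0] by eventually_elim (use rate gap in force)
    then obtain w where "\<tau> \<le> \<sigma> w"
      by (metis (no_types) eventually_at_top_linorder order_refl)
    then show ?thesis
      using T_downward \<sigma>_in_T by blast
  qed
  define X where "X w = Complex (\<rho> w) y0" for w
  define a where "a = Complex \<tau> y0"
  have X_lim: "(X \<longlongrightarrow> a) at_top"
    unfolding X_def a_def using \<tau>_lim by (intro tendsto_Complex) auto
  have aT: "a \<in> {z. Re z \<in> T}"
    using \<open>\<tau> \<in> T\<close> by (simp add: a_def)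
  have XT: "X w \<in> {z. Re z \<in> T}" for w
    using T_downward[OF less_imp_le[OF less_\<tau>] \<open>\<tau> \<in> T\<close>] by (simp add: X_def)
  have cont: "isCont G a" "isCont (deriv G) a"
    using aT open_strip holomorphic_on_imp_continuous_on[OF G(1)]
      holomorphic_on_imp_continuous_on[OF holomorphic_deriv[OF G(1) open_strip]]
    by (simp_all add: continuous_on_eq_continuous_at)
  \<comment> \<open>The continued equation solved for \<open>G (X w)\<close>: as
    \<open>deriv G\<close> stays bounded near \<open>a\<close>, the values of \<open>G\<close> tend
    to 0.\<close>
  have "((\<lambda>w. - of_real (exp (- w)) * deriv G (X w)) \<longlongrightarrow> - of_real 0 * deriv G a) at_top"
    by (intro tendsto_intros isCont_tendsto_compose[OF cont(2)] X_lim) real_asymp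
  moreover have "- of_real (exp (- w)) * deriv G (X w) = G (X w)" for w
    using ode_neg[of w] by (simp add: X_def exp_minus field_simps)
  moreover have "((\<lambda>w. G (X w)) \<longlongrightarrow> G a) at_top"
    by (intro isCont_tendsto_compose[OF cont(1)] X_lim)
  ultimately have Ga: "G a = 0"
    using tendsto_unique[OF trivial_limit_at_top_linorder, of "\<lambda>w. G (X w)" "G a" 0] by simp
  have conn: "connected {z. Re z \<in> T}"
    using convex_linear_vimage[OF bounded_linear.linear[OF bounded_linear_Re] T(2)]
    by (auto simp: vimage_def intro: convex_connected)
  \<comment> \<open>\<open>G\<close> vanishes at \<open>a\<close> but not at the real point
    \<tau>.\<close>
  have nonconst: "\<not> G constant_on {z. Re z \<in> T}"
    using Ga aT G(2)[OF \<open>\<tau> \<in> T\<close>] \<open>\<tau> \<in> T\<close> unfolding constant_on_def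
    by (metis (mono_tags) Re_complex_of_real mem_Collect_eq)
  obtain k :: nat where k: "k > 0"
    "((\<lambda>w. (X w - a) * deriv G (X w) / G (X w)) \<longlongrightarrow> of_nat k) at_top"
  proof (rule log_derivative_tendsto_order[OF G(1) open_strip conn nonconst aT Ga X_lim])
    show "\<forall>\<^sub>F w in at_top. X w \<noteq> a"
      using less_\<tau> by (auto simp: X_def a_def less_le)
  qed
  \<comment> \<open>The distance to \<open>a\<close> is at most
    \<open>exp (- 2 * w) / (2 * a0)\<close>, while the logarithmic derivative grows only like
    \<open>exp w\<close>; the limit 0 contradicts the positive order \<open>k\<close>.\<close>
  have "((\<lambda>w. (X w - a) * deriv G (X w) / G (X w)) \<longlongrightarrow> 0) at_top"
  proof (rule Lim_null_comparison)
    show "((\<lambda>w. exp (- w) / (2 * a0)) \<longlongrightarrow> 0) at_top"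
      using a0 by real_asymp
    show "\<forall>\<^sub>F w in at_top. norm ((X w - a) * deriv G (X w) / G (X w)) \<le> exp (- w) / (2 * a0)"
      using eventually_ge_at_top[of 0]
    proof eventually_elim
      case (elim w)
      have "X w - a = of_real (\<rho> w - \<tau>)"
        by (simp add: X_def a_def complex_eq_iff)
      then have "norm (X w - a) = \<tau> - \<rho> w"
        using less_\<tau>[of w] by (simp del: of_real_diff)
      \<comment> \<open>Where \<open>G (X w) = 0\<close>, the quotient is 0 by convention and the
        bound holds as well.\<close>
      moreover have "norm (deriv G (X w) / G (X w)) \<le> exp w"
        using ode_neg[of w] by (cases "G (X w) = 0") (auto simp: X_def norm_mult norm_divide)
      ultimately have "norm ((X w - a) * deriv G (X w) / G (X w)) \<le> (\<tau> - \<rho> w) * exp w"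
        using less_\<tau>[of w] by (simp add: norm_mult norm_divide mult_left_mono flip: times_divide_eq_right)
      also have "\<dots> \<le> exp (- 2 * w) / (2 * a0) * exp w"
        using rate[of w] elim by (intro mult_right_mono) auto
      also have "\<dots> = exp (- w) / (2 * a0)"
        by (simp flip: exp_add)
      finally show ?case .
    qed
  qed
  from tendsto_unique[OF trivial_limit_at_top_linorder k(2) this] show False
    using k(1) by simp
qed

end

section \<open>Application to natural exponential families\<close>

theorem theorem1:
  fixes n :: nat and a0 :: real and u1 :: complex and v :: "real \<Rightarrow> real"
  assumes "n \<ge> 1" and "a0 > 0" and "Im u1 > 0"
    and "\<And>u::real. complex_of_real (v u) =
           of_real a0 * of_real u * (of_real u - u1) ^ n * (of_real u - cnj u1) ^ n"
    and "is_nef_variance_function v {0<..}"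
  shows "Re u1 \<le> 0"
proof (rule ccontr)
  assume Re_u1: "\<not> Re u1 \<le> 0"
  interpret variance_polynomial a0 "Re u1" "Im u1" n
    by unfold_locales (use assms in auto)
  have v: "v u = u * pr u" for u
  proof -
    have "(of_real u - u1) * (of_real u - cnj u1) = complex_of_real ((u - Re u1)\<^sup>2 + (Im u1)\<^sup>2)"
      by (simp add: complex_eq_iff power2_eq_square algebra_simps)
    then have "complex_of_real (v u) = of_real (u * pr u)"
      unfolding assms(4) pr_def by (simp add: mult_ac flip: power_mult_distrib)
    then show ?thesis
      by (simp only: of_real_eq_iff)
  qed
  obtain \<beta> where \<beta>: "nef_basis \<beta>" "nef_mean_domain \<beta> = {0<..}"
    "\<And>u. u > 0 \<Longrightarrow> nef_variance \<beta> u = v u"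
    using assms(5) unfolding is_nef_variance_function_def by auto
  define T where "T = nef_params \<beta>"
  define m where "m = nef_mean \<beta>"
  define G where "G = exp_moment \<beta> 0"
  note sets = nef_basis_sets[OF \<beta>(1)]
  have m_image: "m ` T = {0<..}"
    using \<beta>(2) by (simp add: nef_mean_domain_def m_def T_def)
  have m_pos: "m t > 0" if "t \<in> T" for t
    using m_image that by auto
  have m_deriv: "(m has_real_derivative m t * pr (m t)) (at t)" if "t \<in> T" for t
    using nef_mean_has_derivative[OF \<beta>(1), of t] that \<beta>(3)[of "m t"] m_pos[OF that] v
    by (simp add: m_def T_def)
  have G_deriv: "(G has_field_derivative exp_moment \<beta> 1 z) (at z)" if "Re z \<in> T" for z
    using exp_moment_has_field_derivative[OF sets, of z 0] that by (simp add: G_def T_def)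
  have T: "open T" "convex T"
    using open_nef_params[OF \<beta>(1)] convex_nef_params[OF \<beta>(1)] by (simp_all add: T_def)
  have G_hol: "G holomorphic_on {z. Re z \<in> T}"
    unfolding holomorphic_on_def field_differentiable_def
    using G_deriv has_field_derivative_at_within by blast
  have G_nz: "G (of_real t) \<noteq> 0" if "t \<in> T" for t
    using real_exp_moment_0_pos[OF \<beta>(1), of t] that by (simp add: G_def T_def exp_moment_of_real)
  have G_ode: "deriv G (of_real t) = of_real (m t) * G (of_real t)" if "t \<in> T" for t
  proof -
    have "deriv G (of_real t) = of_real (real_exp_moment \<beta> 1 t)"
      using G_deriv[of "of_real t"] that by (simp add: DERIV_imp_deriv exp_moment_of_real)
    also have "real_exp_moment \<beta> 1 t = m t * real_exp_moment \<beta> 0 t"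
      using nef_mean_eq[OF \<beta>(1), of t] real_exp_moment_0_pos[OF \<beta>(1), of t] that
      by (simp add: m_def T_def)
    finally show ?thesis
      by (simp add: G_def exp_moment_of_real)
  qed
  obtain H where H: "H holomorphic_on S"
    "\<And>z. z \<in> S - {0} \<Longrightarrow> (H has_field_derivative (1 / p z - 1 / p 0) / z) (at z)"
    using ex_regular_part by blast
  \<comment> \<open>The integration constant is set to 0 provisionally. The primitive then differs
    from the canonical parameter by a constant \<open>c\<close> on \<open>T\<close>, because the
    derivative of \<open>ln (m t)\<close> is \<open>pr (m t)\<close>, reciprocal to that of the
    primitive. A second interpretation subtracts \<open>c\<close>.\<close>
  interpret \<theta>0: canonical_parameter a0 "Re u1" "Im u1" n H 0
    by unfold_locales (use H in auto)
  obtain c where c: "\<And>t. t \<in> T \<Longrightarrow> \<theta>0.\<theta> (of_real (ln (m t))) - of_real t = c"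
  proof (rule has_vector_derivative_zero_constant[OF T(2)])
    fix t assume t: "t \<in> T"
    have "((\<lambda>t. ln (m t)) has_real_derivative pr (m t)) (at t)"
      using m_pos[OF t] by (auto intro!: derivative_eq_intros m_deriv t)
    then have "((\<lambda>t. complex_of_real (ln (m t))) has_vector_derivative of_real (pr (m t))) (at t)"
      by (rule has_vector_derivative_of_real)
    moreover have "(\<theta>0.\<theta> has_field_derivative of_real (1 / pr (m t))) (at (of_real (ln (m t))))"
      using \<theta>0.\<theta>_deriv[of "of_real (ln (m t))"] m_pos[OF t] of_real_in_S[of "m t"]
      by (simp add: \<theta>0.exp_line p_of_real)
    ultimately have "((\<theta>0.\<theta> \<circ> (\<lambda>t. of_real (ln (m t)))) has_vector_derivative
        of_real (pr (m t)) * of_real (1 / pr (m t))) (at t)"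
      by (rule field_vector_diff_chain_at)
    then have "((\<lambda>t. \<theta>0.\<theta> (of_real (ln (m t)))) has_vector_derivative 1) (at t)"
      using pr_pos[of "m t"] by (simp add: o_def flip: of_real_mult)
    moreover have "(complex_of_real has_vector_derivative 1) (at t)"
      using has_vector_derivative_of_real[OF DERIV_ident] by simp
    ultimately have "((\<lambda>t. \<theta>0.\<theta> (of_real (ln (m t))) - of_real t) has_vector_derivative 1 - 1) (at t)"
      by (rule has_vector_derivative_diff)
    then show "((\<lambda>t. \<theta>0.\<theta> (of_real (ln (m t))) - of_real t) has_vector_derivative 0) (at t within T)"
      by (simp add: has_vector_derivative_at_within)
  qed blast
  interpret \<theta>: canonical_parameter a0 "Re u1" "Im u1" n H c
    by unfold_locales (use H in auto)
  have \<theta>: "\<exists>t\<in>T. \<theta>.\<theta> (of_real w) = of_real t \<and> m t = exp w" for w :: real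
  proof -
    \<comment> \<open>The mean domain is all of (0, \<infinity>), so every \<open>exp w\<close> is
      attained as a mean.\<close>
    obtain t where t: "t \<in> T" "m t = exp w"
      using m_image by (metis exp_gt_zero greaterThan_iff imageE)
    then have "\<theta>.\<theta> (of_real w) = of_real t"
      using c[OF t(1)] by (simp add: \<theta>.\<theta>_def \<theta>0.\<theta>_def algebra_simps)
    with t show ?thesis by blast
  qed
  have "negative_axis_continuation a0 (Re u1) (Im u1) n H c T G"
  proof unfold_locales
    show "Re u1 > 0" "n \<ge> 1"
      using Re_u1 assms(1) by auto
    show "\<exists>t\<in>T. \<theta>.\<theta> (of_real w) = of_real t" for w :: real
      using \<theta> by blast
    show "deriv G (\<theta>.\<theta> (of_real w)) = of_real (exp w) * G (\<theta>.\<theta> (of_real w))" for w :: real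
      using \<theta>[of w] G_ode by metis
  qed (use T G_hol G_nz in auto)
  then show False
    by (rule negative_axis_continuation.inconsistent)
qed

end
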